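(* There exist nonempty two-sided subshifts $(X,T)$ and $(Y,S)$ on finite alphabets, ceiling functions $g:X\to(0,\infty)$ and $h:Y\to(0,\infty)$ each depending only on the central entry, and a factor map $\phi:((X,T)_g,\mathbb R)\to((Y,S)_h,\mathbb R)$ between the associated one-dimensional tiling dynamical systems (flows under functions) such that $\phi$ is simple but not local.
   Context: A (two-sided) subshift $(X,T)$ on a finite alphabet $A$ is a closed subset $X\subset A^{\mathbb Z}$ with $TX=X$, where $T$ is the shift $(Tx)_i=x_{i+1}$. A function $g:X\to(0,\infty)$ depends only on the central entry if $g(x)=g_0(x_0)$ for some $g_0:A\to(0,\infty)$. The flow under the function $g$, denoted $((X,T)_g,\mathbb R)$, is the quotient of $X\times\mathbb R$ (with the quotient topology) by the equivalence relation generated by $(x,s+g(x))\sim(Tx,s)$, with the $\mathbb R$-action induced by $(x,s)u=(x,s+u)$. Every point has a unique representative $(x,s)$ with $x\in X$ and $0\le s<g(x)$; $[x,s]$ denotes the class of $(x,s)$. The point $[x,s]$ with $0\le s<g(x)$ corresponds to the tiling of $\mathbb R$ by closed intervals with labels $x_i$ and lengths $g_0(x_i)$, in which the origin lies $s$ units to the right of the left endpoint of the tile labeled $x_0$; in this way these flows are identified with one-dimensional tiling dynamical systems. A factor map (or code) $\phi:((X,T)_g,\mathbb R)\to((Y,S)_h,\mathbb R)$ is a continuous onto map commuting with the $\mathbb R$-actions. A factor map between subshifts is a continuous onto map commuting with the shifts. The factor map $\phi$ is local if there is an integer $r\ge 0$ such that whenever $x,x'\in X$ satisfy $x_i=x'_i$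 for all $|i|\le r$, and $0\le s<g(x)=g(x')$, then $\phi[x,s]=\phi[x',s]$. The factor map $\phi$ is simple if there are a factor map of subshifts $\pi:(X,T)\to(Y,S)$ and a function $t:X\to\mathbb R$ such that $t(Tx)-t(x)=g(x)-h(\pi x)$ for all $x\in X$, and $\phi[x,s]=[\pi x,0](s+t(x))$ for all $x\in X$, $0\le s<g(x)$. *)

theory Defs
  imports "HOL-Analysis.Analysis"
begin

section \<open>Subshifts\<close>

definition shift :: "(int \<Rightarrow> 'a) \<Rightarrow> int \<Rightarrow> 'a"
  where "shift x = (\<lambda>i. x (i + 1))"

text \<open>The function type \<open>int \<Rightarrow> 'a\<close> carries the product topology.\<close>

definition subshift :: "'a::discrete_topology set \<Rightarrow> (int \<Rightarrow> 'a) set \<Rightarrow> bool"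
  where "subshift A X \<longleftrightarrow>
    finite A \<and> closedin (top_of_set (UNIV \<rightarrow> A)) X \<and> shift ` X = X"

definition subshift_factor_map ::
    "(int \<Rightarrow> 'a::discrete_topology) set \<Rightarrow> (int \<Rightarrow> 'b::discrete_topology) set \<Rightarrow>
     ((int \<Rightarrow> 'a) \<Rightarrow> (int \<Rightarrow> 'b)) \<Rightarrow> bool"
  where "subshift_factor_map X Y \<pi> \<longleftrightarrow>
    continuous_on X \<pi> \<and> \<pi> ` X = Y \<and> (\<forall>x\<in>X. \<pi> (shift x) = shift (\<pi> x))"

definition central_ceiling :: "'a set \<Rightarrow> (int \<Rightarrow> 'a) set \<Rightarrow> ((int \<Rightarrow> 'a) \<Rightarrow> real) \<Rightarrow> bool"
  where "central_ceiling A X g \<longleftrightarrow>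
    (\<exists>g0. (\<forall>a\<in>A. 0 < g0 a) \<and> (\<forall>x\<in>X. g x = g0 (x 0)))"


section \<open>The flow under a function\<close>

definition flow_step ::
    "(int \<Rightarrow> 'a) set \<Rightarrow> ((int \<Rightarrow> 'a) \<Rightarrow> real) \<Rightarrow> (int \<Rightarrow> 'a) \<times> real \<Rightarrow> (int \<Rightarrow> 'a) \<times> real \<Rightarrow> bool"
  where "flow_step X g p q \<longleftrightarrow> (\<exists>x\<in>X. \<exists>s. p = (x, s + g x) \<and> q = (shift x, s))"

definition flow_rel ::
    "(int \<Rightarrow> 'a) set \<Rightarrow> ((int \<Rightarrow> 'a) \<Rightarrow> real) \<Rightarrow> (((int \<Rightarrow> 'a) \<times> real) \<times> ((int \<Rightarrow> 'a) \<times> real)) set"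
  where "flow_rel X g = Restr {(p, q). equivclp (flow_step X g) p q} (X \<times> UNIV)"

text \<open>Points of the flow are equivalence classes.  \<open>flow_point X g x s\<close> is defined for every
  real \<open>s\<close>, not only for \<open>0 \<le> s < g x\<close>.\<close>

definition flow_space ::
    "(int \<Rightarrow> 'a) set \<Rightarrow> ((int \<Rightarrow> 'a) \<Rightarrow> real) \<Rightarrow> ((int \<Rightarrow> 'a) \<times> real) set set"
  where "flow_space X g = (X \<times> UNIV) // flow_rel X g"

definition flow_point ::
    "(int \<Rightarrow> 'a) set \<Rightarrow> ((int \<Rightarrow> 'a) \<Rightarrow> real) \<Rightarrow> (int \<Rightarrow> 'a) \<Rightarrow> real \<Rightarrow> ((int \<Rightarrow> 'a) \<times> real) set"
  where "flow_point X g x s = flow_rel X g `` {(x, s)}"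

definition flow_topology ::
    "(int \<Rightarrow> 'a::discrete_topology) set \<Rightarrow> ((int \<Rightarrow> 'a) \<Rightarrow> real) \<Rightarrow>
     ((int \<Rightarrow> 'a) \<times> real) set topology"
  where "flow_topology X g = topology (\<lambda>U. U \<subseteq> flow_space X g \<and>
    openin (top_of_set (X \<times> UNIV)) {p \<in> X \<times> UNIV. flow_rel X g `` {p} \<in> U})"

text \<open>The relation is invariant under translation of the real coordinate, so translating a
  class elementwise gives the induced action; see \<open>flow_act_point\<close> below.\<close>

definition flow_act :: "((int \<Rightarrow> 'a) \<times> real) set \<Rightarrow> real \<Rightarrow> ((int \<Rightarrow> 'a) \<times> real) set"
  where "flow_act P u = (\<lambda>(x, s). (x, s + u)) ` P"

lemma equiv_flow_rel: "equiv (X \<times> UNIV) (flow_rel X g)"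
  by (rule equivI)
    (auto simp: flow_rel_def refl_on_def sym_def trans_def
      intro: equivclp_sym equivclp_trans)

lemma openin_flow_topology:
  "openin (flow_topology X g) U \<longleftrightarrow> U \<subseteq> flow_space X g \<and>
    openin (top_of_set (X \<times> UNIV)) {p \<in> X \<times> UNIV. flow_rel X g `` {p} \<in> U}"
proof -
  let ?V = "\<lambda>U. {p \<in> X \<times> (UNIV::real set). flow_rel X g `` {p} \<in> U}"
  have int: "?V (S \<inter> T) = ?V S \<inter> ?V T" for S T by blast
  have un: "?V (\<Union>\<K>) = (\<Union>K\<in>\<K>. ?V K)" for \<K> by blast
  have "istopology (\<lambda>U. U \<subseteq> flow_space X g \<and> openin (top_of_set (X \<times> UNIV)) (?V U))"
    unfolding istopology_def int un by (blast intro: openin_Int openin_Union)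
  then show ?thesis
    unfolding flow_topology_def by (simp add: topology_inverse')
qed

lemma topspace_flow_topology [simp]: "topspace (flow_topology X g) = flow_space X g"
proof -
  have "{p \<in> X \<times> (UNIV::real set). flow_rel X g `` {p} \<in> flow_space X g} = X \<times> UNIV"
    by (auto simp: flow_space_def intro: quotientI)
  then have "openin (flow_topology X g) (flow_space X g)"
    by (simp add: openin_flow_topology del: mem_Sigma_iff)
  then show ?thesis
    by (metis openin_flow_topology openin_subset openin_topspace subset_antisym)
qed

lemma quotient_map_flow_topology:
  "quotient_map (top_of_set (X \<times> UNIV)) (flow_topology X g) (\<lambda>p. flow_rel X g `` {p})"
  unfolding quotient_map_def openin_flow_topology
  by (auto simp: flow_space_def quotient_def)

lemma equivclp_flow_step_translate:
  assumes "equivclp (flow_step X g) p q"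
  shows "equivclp (flow_step X g) (fst p, snd p + u) (fst q, snd q + u)"
  using assms
proof (induction rule: equivclp_induct)
  case base
  show ?case by simp
next
  case (step y z)
  have "flow_step X g (fst a, snd a + u) (fst b, snd b + u)" if "flow_step X g a b" for a b
    using that unfolding flow_step_def by (force simp: algebra_simps)
  with step.hyps(2)
  have "equivclp (flow_step X g) (fst y, snd y + u) (fst z, snd z + u)"
    by (blast intro: equivclp_sym)
  with step.IH show ?case by (rule equivclp_trans)
qed

lemma flow_act_point: "flow_act (flow_point X g x s) u = flow_point X g x (s + u)"
proof -
  have "((x, s + v), (y, r + v)) \<in> flow_rel X g" if "((x, s), (y, r)) \<in> flow_rel X g" for s v y r
    using that equivclp_flow_step_translate[of X g "(x, s)" "(y, r)" v]
    by (simp add: flow_rel_def)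
  from this[of s _ _ u] this[of "s + u" _ _ "- u"] show ?thesis
    unfolding flow_act_def flow_point_def by (force simp: image_iff)
qed


section \<open>Factor maps of flows\<close>

definition flow_factor_map ::
    "(int \<Rightarrow> 'a::discrete_topology) set \<Rightarrow> ((int \<Rightarrow> 'a) \<Rightarrow> real) \<Rightarrow>
     (int \<Rightarrow> 'b::discrete_topology) set \<Rightarrow> ((int \<Rightarrow> 'b) \<Rightarrow> real) \<Rightarrow>
     (((int \<Rightarrow> 'a) \<times> real) set \<Rightarrow> ((int \<Rightarrow> 'b) \<times> real) set) \<Rightarrow> bool"
  where "flow_factor_map X g Y h \<phi> \<longleftrightarrow>
    continuous_map (flow_topology X g) (flow_topology Y h) \<phi> \<and>
    \<phi> ` flow_space X g = flow_space Y h \<and>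
    (\<forall>P\<in>flow_space X g. \<forall>u. \<phi> (flow_act P u) = flow_act (\<phi> P) u)"

text \<open>Locality asks for equality of the images as points of the target flow.\<close>

definition local_code ::
    "(int \<Rightarrow> 'a) set \<Rightarrow> ((int \<Rightarrow> 'a) \<Rightarrow> real) \<Rightarrow>
     (((int \<Rightarrow> 'a) \<times> real) set \<Rightarrow> ((int \<Rightarrow> 'b) \<times> real) set) \<Rightarrow> bool"
  where "local_code X g \<phi> \<longleftrightarrow>
    (\<exists>r\<ge>0. \<forall>x\<in>X. \<forall>x'\<in>X. \<forall>s.
      (\<forall>i. \<bar>i\<bar> \<le> r \<longrightarrow> x i = x' i) \<and> 0 \<le> s \<and> s < g x \<and> g x = g x' \<longrightarrow>
      \<phi> (flow_point X g x s) = \<phi> (flow_point X g x' s))"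

definition simple_code ::
    "(int \<Rightarrow> 'a::discrete_topology) set \<Rightarrow> ((int \<Rightarrow> 'a) \<Rightarrow> real) \<Rightarrow>
     (int \<Rightarrow> 'b::discrete_topology) set \<Rightarrow> ((int \<Rightarrow> 'b) \<Rightarrow> real) \<Rightarrow>
     (((int \<Rightarrow> 'a) \<times> real) set \<Rightarrow> ((int \<Rightarrow> 'b) \<times> real) set) \<Rightarrow> bool"
  where "simple_code X g Y h \<phi> \<longleftrightarrow>
    (\<exists>\<pi> t. subshift_factor_map X Y \<pi> \<and>
      (\<forall>x\<in>X. t (shift x) - t x = g x - h (\<pi> x)) \<and>
      (\<forall>x\<in>X. \<forall>s. 0 \<le> s \<and> s < g x \<longrightarrow>
        \<phi> (flow_point X g x s) = flow_act (flow_point Y h (\<pi> x) 0) (s + t x)))"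

end

theory Submission
  imports Defs
begin

text \<open>Take the 0-1 sequences in which the ones are equally spaced, unit ceilings on both sides, and
  translate each orbit of the flow by an amount \<open>t\<close> that depends only on the spacing.  Points with
  large spacing look alike near the origin, so if \<open>t\<close> tends to 0 as the spacing grows, then \<open>t\<close> is
  continuous, although no window of fixed size determines it.  The amounts lie in \<open>[0, 1)\<close>, so
  already the positions of the tile boundaries in the image distinguish different values of \<open>t\<close>.\<close>

section \<open>Translating the orbits of a flow\<close>

definition orbit_translation ::
    "((int \<Rightarrow> 'a) \<Rightarrow> real) \<Rightarrow> ((int \<Rightarrow> 'a) \<times> real) set \<Rightarrow> ((int \<Rightarrow> 'a) \<times> real) set"
  where "orbit_translation t P = (\<lambda>(x, s). (x, s + t x)) ` P"

lemma equivclp_flow_step_invariant: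
  assumes "equivclp (flow_step X g) p q"
    and inv: "\<And>x. x \<in> X \<Longrightarrow> t (shift x) = t x"
  shows "t (fst q) = t (fst p)"
  using assms(1)
proof (induction rule: equivclp_induct)
  case (step y z)
  then show ?case using inv by (auto simp: flow_step_def)
qed simp

text \<open>A shift-invariant \<open>t\<close> is constant on each equivalence class, so the
  elementwise translation moves the whole class by the single amount \<open>t x\<close> and agrees
  there with \<open>flow_act\<close>.\<close>

lemma orbit_translation_point:
  assumes "\<And>x. x \<in> X \<Longrightarrow> t (shift x) = t x"
  shows "orbit_translation t (flow_point X g x s) = flow_point X g x (s + t x)"
proof -
  have "t y = t x" if "(y, r) \<in> flow_point X g x s" for y r
    using that equivclp_flow_step_invariant[of X g "(x, s)" "(y, r)" t] assms
    by (auto simp: flow_point_def flow_rel_def)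
  then have "orbit_translation t (flow_point X g x s) = flow_act (flow_point X g x s) (t x)"
    unfolding orbit_translation_def flow_act_def by (intro image_cong) auto
  then show ?thesis by (simp add: flow_act_point)
qed

lemma flow_spaceE:
  assumes "P \<in> flow_space X g"
  obtains x s where "x \<in> X" "P = flow_point X g x s"
  using assms by (auto simp: flow_space_def flow_point_def quotient_def)

lemma flow_point_in_space: "x \<in> X \<Longrightarrow> flow_point X g x s \<in> flow_space X g"
  by (auto simp: flow_space_def flow_point_def intro: quotientI)

text \<open>Continuity is checked before identification, on \<open>X \<times> UNIV\<close>, and
  descends through the quotient map. Surjectivity comes from translating back by \<open>t x\<close>,
  and equivariance from the fact that translations commute.\<close>

lemma flow_factor_map_orbit_translation:
  assumes inv: "\<And>x. x \<in> X \<Longrightarrow> t (shift x) = t x"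
    and cont: "continuous_on X t"
  shows "flow_factor_map X g X g (orbit_translation t)"
  unfolding flow_factor_map_def
proof (intro conjI ballI allI)
  let ?q = "\<lambda>p. flow_rel X g `` {p}"
  let ?f = "\<lambda>p. (fst p, snd p + t (fst p))"
  have "continuous_on (X \<times> UNIV) ?f"
    by (intro continuous_intros continuous_on_compose2[OF cont]) auto
  then have "continuous_map (top_of_set (X \<times> UNIV)) (top_of_set (X \<times> UNIV)) ?f"
    by auto
  then have "continuous_map (top_of_set (X \<times> UNIV)) (flow_topology X g) (?q \<circ> ?f)"
    by (rule continuous_map_compose)
      (rule quotient_imp_continuous_map[OF quotient_map_flow_topology])
  moreover have "orbit_translation t \<circ> ?q = ?q \<circ> ?f"
    using orbit_translation_point[of X t, OF inv] by (auto simp: flow_point_def)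
  ultimately show "continuous_map (flow_topology X g) (flow_topology X g) (orbit_translation t)"
    by (intro continuous_compose_quotient_map[OF quotient_map_flow_topology]) (simp only:)
  show "orbit_translation t ` flow_space X g = flow_space X g"
  proof (intro equalityI subsetI)
    fix Q assume "Q \<in> flow_space X g"
    then obtain x s where "x \<in> X" "Q = flow_point X g x s" by (rule flow_spaceE)
    then have "Q = orbit_translation t (flow_point X g x (s - t x))"
      by (simp add: orbit_translation_point[of X t, OF inv])
    then show "Q \<in> orbit_translation t ` flow_space X g"
      using \<open>x \<in> X\<close> by (blast intro: flow_point_in_space)
  next
    fix Q assume "Q \<in> orbit_translation t ` flow_space X g"
    then obtain x s where "x \<in> X" "Q = orbit_translation t (flow_point X g x s)"
      by (blast elim: flow_spaceE)
    then show "Q \<in> flow_space X g"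
      by (simp add: orbit_translation_point[of X t, OF inv] flow_point_in_space)
  qed
next
  fix P u
  assume "P \<in> flow_space X g"
  then show "orbit_translation t (flow_act P u) = flow_act (orbit_translation t P) u"
    by (elim flow_spaceE) (simp add: orbit_translation_point[of X t, OF inv] flow_act_point add_ac)
qed

text \<open>The identity serves as the map of subshifts. With equal ceilings the cocycle equation
  reduces to invariance of \<open>t\<close>.\<close>

lemma simple_code_orbit_translation:
  assumes inv: "\<And>x. x \<in> X \<Longrightarrow> t (shift x) = t x"
  shows "simple_code X g X g (orbit_translation t)"
  unfolding simple_code_def subshift_factor_map_def
  by (rule exI[of _ "\<lambda>x. x"], rule exI[of _ t])
    (simp add: inv orbit_translation_point[of X t, OF inv] flow_act_point)

text \<open>Each generating step changes the real coordinate by exactly 1, so its fractional part is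
  an invariant of the class.\<close>

lemma flow_point_unit_ceiling_eqD:
  assumes "x \<in> X" and "flow_point X (\<lambda>_. 1) x s = flow_point X (\<lambda>_. 1) y r"
  shows "r - s \<in> \<int>"
proof -
  \<comment> \<open>Membership of \<open>x\<close> in \<open>X\<close> matters here: outside
    \<open>X\<close> the class is empty and equality says nothing.\<close>
  have "(x, s) \<in> flow_point X (\<lambda>_. 1) x s"
    using assms(1) by (simp add: flow_point_def flow_rel_def)
  then have "equivclp (flow_step X (\<lambda>_. 1)) (y, r) (x, s)"
    unfolding assms(2) by (simp add: flow_point_def flow_rel_def)
  then have "r - snd (x, s) \<in> \<int>"
  proof (induction rule: equivclp_induct)
    case (step p q)
    then have "snd p - snd q \<in> \<int>" by (auto simp: flow_step_def)
    with step.IH have "(r - snd p) + (snd p - snd q) \<in> \<int>" by (rule Ints_add)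
    then show ?case by simp
  qed simp
  then show ?thesis by simp
qed


section \<open>Sequences with equally spaced ones\<close>

text \<open>The ones form the empty set or a coset of a subgroup of the integers. The zero sequence
  and the sequences with a single one are included as limits for growing spacing, which makes the
  set closed.\<close>

definition equispaced :: "(int \<Rightarrow> nat) set"
  where "equispaced = {x \<in> UNIV \<rightarrow> {0, 1}.
    \<forall>i d. x i = 1 \<and> x (i + d) = 1 \<longrightarrow> (\<forall>j. x (j + d) = x j)}"

lemma equispaced_le_1: "x \<in> equispaced \<Longrightarrow> x i \<le> 1"
  unfolding equispaced_def Pi_iff by (elim CollectE conjE ballE[of _ _ i]) auto

lemma equispaced_periodic:
  "x \<in> equispaced \<Longrightarrow> x i = 1 \<Longrightarrow> x (i + d) = 1 \<Longrightarrow> x (j + d) = x j"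
  by (auto simp: equispaced_def)

lemma translate_equispaced:
  assumes "x \<in> equispaced"
  shows "(\<lambda>i. x (i + k)) \<in> equispaced"
proof -
  have "x (j + d + k) = x (j + k)" if "x (i + k) = 1" "x (i + d + k) = 1" for i d j
    using equispaced_periodic[OF assms, of "i + k" d "j + k"] that by (simp add: algebra_simps)
  moreover have "(\<lambda>i. x (i + k)) \<in> UNIV \<rightarrow> {0, 1}"
    using assms by (simp add: equispaced_def Pi_iff)
  ultimately show ?thesis unfolding equispaced_def by blast
qed

lemma shift_equispaced: "shift ` equispaced = equispaced"
proof (intro equalityI subsetI)
  fix x assume "x \<in> equispaced"
  then have "(\<lambda>i. x (i + - 1)) \<in> equispaced" by (rule translate_equispaced)
  moreover have "shift (\<lambda>i. x (i + - 1)) = x" by (simp add: shift_def)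
  ultimately show "x \<in> shift ` equispaced" by (metis image_eqI)
qed (auto simp: shift_def intro: translate_equispaced)

lemma subshift_equispaced: "subshift {0, 1} equispaced"
proof -
  \<comment> \<open>An implication defines a closed set when its premise is open and its conclusion
    closed; discreteness of the alphabet makes the premise open.\<close>
  have "open {x :: int \<Rightarrow> nat. x i = 1}" for i
    using open_vimage[OF open_discrete[of "{1 :: nat}"] continuous_on_product_coordinates[of i]]
    by (simp add: vimage_def)
  then have "closed {x :: int \<Rightarrow> nat. \<forall>i d. x i = 1 \<and> x (i + d) = 1 \<longrightarrow> (\<forall>j. x (j + d) = x j)}"
    by (intro closed_Collect_all closed_Collect_imp closed_Collect_eq open_Collect_conj
        continuous_on_product_coordinates)
  then have "closedin (top_of_set (UNIV \<rightarrow> {0, 1})) equispaced"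
    by (auto simp: closedin_closed equispaced_def)
  then show ?thesis by (simp add: subshift_def shift_equispaced)
qed

section \<open>A continuous shift-invariant weight\<close>

definition gap_count :: "nat \<Rightarrow> (int \<Rightarrow> nat) \<Rightarrow> nat"
  where "gap_count d x = (\<Sum>i<d. x (int i) * x (int i + int d))"

text \<open>Shifting the window of length \<open>d\<close> drops the term at 0 and gains the term at
  \<open>d\<close>. These agree, since a pair of ones at distance \<open>d\<close> makes
  \<open>d\<close> a period.\<close>

lemma gap_count_shift:
  assumes "x \<in> equispaced"
  shows "gap_count d (shift x) = gap_count d x"
proof -
  define f where "f i = x (int i) * x (int i + int d)" for i
  have 01: "x i = 0 \<or> x i = 1" for i using equispaced_le_1[OF assms, of i] by linarith
  have "f d = f 0"
    using 01[of 0] 01[of "int d"] 01[of "int d + int d"]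
      equispaced_periodic[OF assms, of 0 "int d" "int d"]
      equispaced_periodic[OF assms, of "int d" "int d" 0]
    by (auto simp: f_def)
  then have "(\<Sum>i<d. f (Suc i)) = (\<Sum>i<d. f i)"
    using sum.lessThan_Suc_shift[of f d] by simp
  then show ?thesis by (simp add: gap_count_def shift_def f_def algebra_simps)
qed

lemma gap_count_le:
  assumes "x \<in> equispaced"
  shows "gap_count d x \<le> d"
proof -
  have "x (int i) * x (int i + int d) \<le> 1" for i
    using mult_le_mono[OF equispaced_le_1[OF assms] equispaced_le_1[OF assms]] by simp
  then show ?thesis
    unfolding gap_count_def using sum_bounded_above[of "{..<d}" _ "1 :: nat"] by simp
qed

lemma continuous_on_gap_count: "continuous_on S (\<lambda>x. real (gap_count d x))"
proof -
  have "continuous_on S (\<lambda>x :: int \<Rightarrow> nat. real (x i))" for i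
    by (intro continuous_on_compose2[OF _ continuous_on_subset[OF
            continuous_on_product_coordinates[of i]]]) auto
  then show ?thesis
    unfolding gap_count_def of_nat_sum of_nat_mult
    by (intro continuous_on_sum continuous_on_mult)
qed

text \<open>On an equispaced sequence \<open>gap_count d x / d\<close> is the density of the ones when \<open>d\<close> is a
  multiple of the spacing, and \<open>0\<close> otherwise.\<close>

definition gap_term :: "nat \<Rightarrow> (int \<Rightarrow> nat) \<Rightarrow> real"
  where "gap_term n x = real (gap_count (Suc n) x) / real (Suc n) * (1 / 2) ^ (n + 2)"

definition gap_weight :: "(int \<Rightarrow> nat) \<Rightarrow> real"
  where "gap_weight x = (\<Sum>n. gap_term n x)"

lemma gap_term_nonneg: "0 \<le> gap_term n x"
  by (simp add: gap_term_def)

lemma gap_term_le: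
  assumes "x \<in> equispaced"
  shows "gap_term n x \<le> (1 / 2) ^ (n + 2)"
proof -
  have "real (gap_count (Suc n) x) / real (Suc n) \<le> 1"
    using gap_count_le[OF assms, of "Suc n"] by (simp add: divide_le_eq_1 del: of_nat_Suc)
  then show ?thesis
    unfolding gap_term_def by (intro mult_left_le_one_le) auto
qed

text \<open>This majorant serves the M-test, and the exponent \<open>n + 2\<close> brings its sum
  down to 1/2, keeping the weight strictly below 1.\<close>

lemma half_powers_sums: "(\<lambda>n. (1 / 2 :: real) ^ (n + 2)) sums (1 / 2)"
  using sums_mult[OF geometric_sums[of "1 / 2 :: real"], of "1 / 4"]
  by (simp add: power_add mult.commute)

lemma summable_gap_term:
  assumes "x \<in> equispaced"
  shows "summable (\<lambda>n. gap_term n x)"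
  using gap_term_le[OF assms] gap_term_nonneg
  by (intro summable_comparison_test'[OF sums_summable[OF half_powers_sums], of 0]) auto

lemma gap_weight_less_1:
  assumes "x \<in> equispaced"
  shows "gap_weight x < 1"
proof -
  have "gap_weight x \<le> 1 / 2"
    unfolding gap_weight_def
    by (rule sums_le[OF gap_term_le[OF assms] summable_sums[OF summable_gap_term[OF assms]]
          half_powers_sums])
  then show ?thesis by simp
qed

lemma gap_weight_shift: "x \<in> equispaced \<Longrightarrow> gap_weight (shift x) = gap_weight x"
  by (simp add: gap_weight_def gap_term_def gap_count_shift)

text \<open>Each term reads finitely many entries and is continuous; the geometric majorant makes
  the series converge uniformly.\<close>

lemma continuous_on_gap_weight: "continuous_on equispaced gap_weight"
proof -
  have "uniform_limit equispaced (\<lambda>n x. \<Sum>i<n. gap_term i x) (\<lambda>x. \<Sum>i. gap_term i x) sequentially"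
    using gap_term_le gap_term_nonneg
    by (intro Weierstrass_m_test[OF _ sums_summable[OF half_powers_sums]]) auto
  moreover have "continuous_on equispaced (\<lambda>x. \<Sum>i<n. gap_term i x)" for n
    unfolding gap_term_def by (intro continuous_intros continuous_on_gap_count) auto
  ultimately show ?thesis
    unfolding gap_weight_def[abs_def] by (intro uniform_limit_theorem) auto
qed


section \<open>Locality fails\<close>

text \<open>The pointwise limit of \<open>periodic_ones n\<close> as \<open>n\<close> grows.\<close>

definition single_one :: "int \<Rightarrow> nat"
  where "single_one i = of_bool (i = 0)"

definition periodic_ones :: "int \<Rightarrow> int \<Rightarrow> nat"
  where "periodic_ones n i = of_bool (n dvd i)"

lemma single_one_equispaced: "single_one \<in> equispaced"
  by (auto simp: equispaced_def single_one_def)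

lemma periodic_ones_equispaced: "periodic_ones n \<in> equispaced"
proof -
  have "periodic_ones n (j + d) = periodic_ones n j"
    if "periodic_ones n i = 1" "periodic_ones n (i + d) = 1" for i d j
  proof -
    have "n dvd i" "n dvd i + d" using that unfolding periodic_ones_def of_bool_eq_1_iff by blast+
    then have "n dvd d" using dvd_add_right_iff by blast
    then show ?thesis unfolding periodic_ones_def by (simp only: dvd_add_left_iff)
  qed
  moreover have "periodic_ones n \<in> UNIV \<rightarrow> {0, 1}" by (simp add: periodic_ones_def)
  ultimately show ?thesis unfolding equispaced_def by blast
qed

lemma gap_weight_single_one: "gap_weight single_one = 0"
  by (simp add: gap_weight_def gap_term_def gap_count_def single_one_def)

lemma gap_weight_periodic_ones: "0 < gap_weight (periodic_ones (int (Suc n)))"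
proof -
  let ?x = "periodic_ones (int (Suc n))"
  \<comment> \<open>The ones at 0 and \<open>Suc n\<close> already contribute one pair at distance
    \<open>Suc n\<close>.\<close>
  have "?x (int 0) * ?x (int 0 + int (Suc n)) \<le> gap_count (Suc n) ?x"
    unfolding gap_count_def by (rule member_le_sum) auto
  then have "0 < gap_count (Suc n) ?x" by (simp add: periodic_ones_def)
  then have "0 < gap_term n ?x" by (simp add: gap_term_def)
  then show ?thesis
    unfolding gap_weight_def
    by (intro suminf_pos2[OF summable_gap_term[OF periodic_ones_equispaced] gap_term_nonneg])
qed

lemma not_local_gap_weight:
  "\<not> local_code equispaced (\<lambda>_. 1) (orbit_translation gap_weight)"
proof
  let ?pt = "flow_point equispaced (\<lambda>_. 1)"
  assume "local_code equispaced (\<lambda>_. 1) (orbit_translation gap_weight)"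
  then obtain r :: int where "r \<ge> 0" and r: "\<forall>x\<in>equispaced. \<forall>x'\<in>equispaced. \<forall>s.
      (\<forall>i. \<bar>i\<bar> \<le> r \<longrightarrow> x i = x' i) \<and> 0 \<le> s \<and> s < 1 \<and> (1 :: real) = 1 \<longrightarrow>
      orbit_translation gap_weight (?pt x s) = orbit_translation gap_weight (?pt x' s)"
    unfolding local_code_def by (elim exE conjE)
  \<comment> \<open>With period \<open>r + 1\<close>, the only multiple in the window from
    \<open>-r\<close> to \<open>r\<close> is 0, so \<open>x\<close> agrees there with
    \<open>single_one\<close>.\<close>
  define x where "x = periodic_ones (int (Suc (nat r)))"
  have x: "x \<in> equispaced" by (simp add: x_def periodic_ones_equispaced)
  have "single_one i = x i" if "\<bar>i\<bar> \<le> r" for i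
    using that \<open>r \<ge> 0\<close> dvd_imp_le_int[of i "int (Suc (nat r))"]
    by (auto simp: x_def single_one_def periodic_ones_def)
  then have "orbit_translation gap_weight (?pt single_one 0) = orbit_translation gap_weight (?pt x 0)"
    using r[rule_format, OF single_one_equispaced x, of 0] by simp
  then have "?pt single_one (0 + gap_weight single_one) = ?pt x (0 + gap_weight x)"
    by (simp only: orbit_translation_point[of equispaced gap_weight, OF gap_weight_shift])
  then have "gap_weight x \<in> \<int>"
    using flow_point_unit_ceiling_eqD[OF single_one_equispaced, of 0 x "gap_weight x"]
    by (simp add: gap_weight_single_one)
  moreover have "0 < gap_weight x" "gap_weight x < 1"
    using x by (simp_all only: x_def gap_weight_periodic_ones gap_weight_less_1)
  ultimately show False by (auto elim!: Ints_cases)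
qed

theorem mainTheorem1:
  shows "\<exists>(A :: nat set) (B :: nat set) (X :: (int \<Rightarrow> nat) set) (Y :: (int \<Rightarrow> nat) set) g h \<phi>.
    subshift A X \<and> X \<noteq> {} \<and> subshift B Y \<and> Y \<noteq> {} \<and>
    central_ceiling A X g \<and> central_ceiling B Y h \<and>
    flow_factor_map X g Y h \<phi> \<and>
    simple_code X g Y h \<phi> \<and> \<not> local_code X g \<phi>"
proof -
  have "central_ceiling {0, 1} equispaced (\<lambda>_. 1)"
    unfolding central_ceiling_def by (intro exI[of _ "\<lambda>_. 1"]) auto
  then show ?thesis
    using subshift_equispaced single_one_equispaced not_local_gap_weight
      flow_factor_map_orbit_translation[of equispaced gap_weight "\<lambda>_. 1", OF gap_weight_shift
        continuous_on_gap_weight]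
      simple_code_orbit_translation[of equispaced gap_weight "\<lambda>_. 1", OF gap_weight_shift]
    by blast
qed

end
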